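(* Let the dominated model $\mathscr{P}$ be totally bounded with respect to the Hellinger metric $H$ and let $X_1,X_2,\ldots$ be i.i.d.-$P_0$ for some $P_0\in\mathscr{P}$. Assume that there exist a constant $L>0$ and a Hellinger ball $B'$ centred on $P_0$ such that for all $P\in\mathscr{P}$ and $Q\in B'$, \[ \Bigl\|\frac{p}{q}\Bigr\|_{2,Q}=\Bigl(\int\frac{p^2}{q}\,d\mu\Bigr)^{1/2}<L. \] Finally assume that $\Pi(B)>0$ for any Hellinger neighbourhood $B$ of $P_0$. Then the posterior is Hellinger consistent, $P_0$-almost surely: for every $\epsilon>0$, \[ \Pi\bigl(P\in\mathscr{P}:H(P,P_0)>\epsilon\bigm|X_1,\ldots,X_n\bigr)\longrightarrow0,\qquad P_0\text{-almost surely}. \]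
   Context: Setting. $(\mathscr{X},\mathscr{A})$ is a measurable space (the sample space). The model $\mathscr{P}$ is a collection of probability measures on $(\mathscr{X},\mathscr{A})$ dominated by a $\sigma$-finite measure $\mu$, with densities $p=dP/d\mu$, $q=dQ/d\mu$; it carries a $\sigma$-algebra $\mathscr{B}$ such that $P\mapsto P(A)$ is measurable for every $A\in\mathscr{A}$ (densities are taken measurable in $(x,P)$, and model subsets to which $\Pi$ is applied are measurable). The prior $\Pi$ is a probability measure on $(\mathscr{P},\mathscr{B})$. The posterior is \[ \Pi(A\mid X_1,\ldots,X_n)=\int_A\prod_{i=1}^n p(X_i)\,d\Pi(P)\Bigm/\int_{\mathscr{P}}\prod_{i=1}^n p(X_i)\,d\Pi(P). \] "$P_0$-almost surely" refers to $P_0^\infty$. The Hellinger metric is $H(P,Q)=\bigl(\int(\sqrt p-\sqrt q)^2\,d\mu\bigr)^{1/2}$. Balls and neighbourhoods are taken within $\mathscr{P}$. The finiteness of $\int p^2/q\,d\mu$ includes that $q>0$ $\mu$-almost everywhere on $\{p>0\}$. *)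

theory Defs
  imports "HOL-Probability.Probability"
begin

text \<open>
  The prior \<^term>\<open>prior\<close> carries the model: \<^term>\<open>space prior\<close> is the collection of probability
  measures, \<^term>\<open>sets prior\<close> the sigma-algebra on it. \<^term>\<open>p P\<close> is a version of the density of
  \<^term>\<open>P\<close> with respect to \<^term>\<open>mu\<close>. Domination of the model by \<^term>\<open>mu\<close>, and
  \<^term>\<open>sets P = sets mu\<close>, are contained in \<open>is_density\<close>.
\<close>

locale dominated_model =
  mu: sigma_finite_measure mu + prior: prob_space prior
  for mu :: "'a measure" and prior :: "'a measure measure" and p :: "'a measure \<Rightarrow> 'a \<Rightarrow> real" +
  assumes model_prob: "P \<in> space prior \<Longrightarrow> prob_space P"
    and is_density: "P \<in> space prior \<Longrightarrow> density mu (\<lambda>x. ennreal (p P x)) = P"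
    and density_nonneg: "P \<in> space prior \<Longrightarrow> x \<in> space mu \<Longrightarrow> 0 \<le> p P x"
    and density_measurable: "(\<lambda>(x, P). p P x) \<in> borel_measurable (mu \<Otimes>\<^sub>M prior)"
    and evaluation_measurable: "A \<in> sets mu \<Longrightarrow> (\<lambda>P. emeasure P A) \<in> borel_measurable prior"

definition hellinger :: "'a measure \<Rightarrow> ('a measure \<Rightarrow> 'a \<Rightarrow> real) \<Rightarrow> 'a measure \<Rightarrow> 'a measure \<Rightarrow> real"
  where "hellinger mu p P Q = sqrt (\<integral>x. (sqrt (p P x) - sqrt (p Q x))\<^sup>2 \<partial>mu)"

text \<open>
  The norm of \<open>f/g\<close> in \<open>L\<^sup>2\<close> of the measure with density \<open>g\<close>, namely
  \<open>(\<integral> f\<^sup>2/g d mu)\<^bsup>1/2\<^esup>\<close>, as an extended real. In \<^typ>\<open>ennreal\<close> one has \<open>0 / 0 = 0\<close> and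
  \<open>a / 0 = \<infinity>\<close> for \<open>a > 0\<close>, so that finiteness includes \<open>g > 0\<close> almost everywhere on \<open>{f > 0}\<close>.
\<close>

definition ratio_norm2 :: "'a measure \<Rightarrow> ('a \<Rightarrow> real) \<Rightarrow> ('a \<Rightarrow> real) \<Rightarrow> ennreal"
  where "ratio_norm2 mu f g =
    (let I = \<integral>\<^sup>+x. (ennreal (f x))\<^sup>2 / ennreal (g x) \<partial>mu
     in if I = \<infinity> then \<infinity> else ennreal (sqrt (enn2real I)))"

text \<open>
  The observations \<open>X\<^sub>1, \<dots>, X\<^sub>n\<close> are \<open>X 0, \<dots>, X (n - 1)\<close>. The quotient is the usual one whenever the
  denominator is neither \<open>0\<close> nor \<open>\<infinity>\<close>; otherwise it takes a conventional value.
\<close>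

definition posterior ::
    "'a measure measure \<Rightarrow> ('a measure \<Rightarrow> 'a \<Rightarrow> real) \<Rightarrow> nat \<Rightarrow> (nat \<Rightarrow> 'a) \<Rightarrow> 'a measure set \<Rightarrow> ennreal"
  where "posterior prior p n X A =
    (\<integral>\<^sup>+P\<in>A. (\<Prod>i<n. ennreal (p P (X i))) \<partial>prior) / (\<integral>\<^sup>+P. (\<Prod>i<n. ennreal (p P (X i))) \<partial>prior)"

text \<open>
  That the Hellinger distance is a metric on the model gives access to the library's balls and
  total boundedness.
\<close>

lemma sqrt_integral_square_triangle:
  fixes a b :: "'a \<Rightarrow> real"
  assumes [measurable]: "a \<in> borel_measurable M" "b \<in> borel_measurable M"
    and ia: "integrable M (\<lambda>x. (a x)\<^sup>2)" and ib: "integrable M (\<lambda>x. (b x)\<^sup>2)"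
  shows "sqrt (\<integral>x. (a x + b x)\<^sup>2 \<partial>M) \<le> sqrt (\<integral>x. (a x)\<^sup>2 \<partial>M) + sqrt (\<integral>x. (b x)\<^sup>2 \<partial>M)"
proof -
  define A where "A = sqrt (\<integral>x. (a x)\<^sup>2 \<partial>M)"
  define B where "B = sqrt (\<integral>x. (b x)\<^sup>2 \<partial>M)"
  have A2: "(\<integral>x. (a x)\<^sup>2 \<partial>M) = A\<^sup>2" and B2: "(\<integral>x. (b x)\<^sup>2 \<partial>M) = B\<^sup>2"
    unfolding A_def B_def by simp_all
  have nn: "A \<ge> 0" "B \<ge> 0" unfolding A_def B_def by simp_all
  have iab: "integrable M (\<lambda>x. a x * b x)"
  proof (rule Bochner_Integration.integrable_bound)
    show "integrable M (\<lambda>x. (a x)\<^sup>2 + (b x)\<^sup>2)" using ia ib by simp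
    have "\<bar>u * v\<bar> \<le> u\<^sup>2 + v\<^sup>2" for u v :: real
    proof -
      have "2 * \<bar>u * v\<bar> \<le> u\<^sup>2 + v\<^sup>2"
        using sum_squares_bound[of "\<bar>u\<bar>" "\<bar>v\<bar>"] by (simp add: abs_mult)
      then show ?thesis using abs_ge_zero[of "u * v"] by linarith
    qed
    then show "AE x in M. norm (a x * b x) \<le> norm ((a x)\<^sup>2 + (b x)\<^sup>2)" by simp
  qed simp
  have quad: "0 \<le> s\<^sup>2 * A\<^sup>2 - 2 * s * t * (\<integral>x. a x * b x \<partial>M) + t\<^sup>2 * B\<^sup>2" for s t
  proof -
    have "0 \<le> (\<integral>x. (s * a x - t * b x)\<^sup>2 \<partial>M)" by simp
    also have "(\<lambda>x. (s * a x - t * b x)\<^sup>2) =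
        (\<lambda>x. s\<^sup>2 * (a x)\<^sup>2 - (2 * s * t) * (a x * b x) + t\<^sup>2 * (b x)\<^sup>2)"
      by (simp add: power2_eq_square algebra_simps)
    also have "(\<integral>x. s\<^sup>2 * (a x)\<^sup>2 - (2 * s * t) * (a x * b x) + t\<^sup>2 * (b x)\<^sup>2 \<partial>M) =
        s\<^sup>2 * A\<^sup>2 - (2 * s * t) * (\<integral>x. a x * b x \<partial>M) + t\<^sup>2 * B\<^sup>2"
      using ia ib iab by (simp add: A2 B2)
    finally show ?thesis .
  qed
  have cs: "(\<integral>x. a x * b x \<partial>M) \<le> A * B"
  proof (cases "A > 0 \<and> B > 0")
    case True
    have "2 * (A * B) * (\<integral>x. a x * b x \<partial>M) \<le> 2 * (A * B) * (A * B)"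
      using quad[of B A] by (simp add: power2_eq_square algebra_simps)
    then show ?thesis using True by simp
  next
    case False
    let ?C = "\<integral>x. a x * b x \<partial>M"
    have z: "A = 0 \<or> B = 0" using False nn by auto
    have "?C = 0"
    proof (rule ccontr)
      assume C: "?C \<noteq> 0"
      show False
      proof (cases "A = 0")
        case True
        then show False using quad[of "(B\<^sup>2 + 1) / (2 * ?C)" 1] C by simp
      next
        case False
        then show False using z quad[of 1 "(A\<^sup>2 + 1) / (2 * ?C)"] C by simp
      qed
    qed
    then show ?thesis using z by auto
  qed
  have "(\<integral>x. (a x + b x)\<^sup>2 \<partial>M) = (\<integral>x. (a x)\<^sup>2 + 2 * (a x * b x) + (b x)\<^sup>2 \<partial>M)"
    by (simp add: power2_eq_square algebra_simps)
  also have "\<dots> = A\<^sup>2 + 2 * (\<integral>x. a x * b x \<partial>M) + B\<^sup>2"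
    using ia ib iab by (simp add: A2 B2)
  also have "\<dots> \<le> (A + B)\<^sup>2" using cs by (simp add: power2_eq_square algebra_simps)
  finally have "sqrt (\<integral>x. (a x + b x)\<^sup>2 \<partial>M) \<le> sqrt ((A + B)\<^sup>2)" by (rule real_sqrt_le_mono)
  then show ?thesis using nn by (simp add: A_def B_def)
qed

context dominated_model
begin

lemma density_borel:
  assumes "P \<in> space prior" shows "p P \<in> borel_measurable mu"
  using measurable_compose[OF measurable_Pair2'[OF assms] density_measurable] by simp

lemma density_integrable:
  assumes P: "P \<in> space prior" shows "integrable mu (p P)"
proof (rule integrableI_nn_integral_finite)
  show "p P \<in> borel_measurable mu" using P by (rule density_borel)
  show "AE x in mu. 0 \<le> p P x" using density_nonneg[OF P] by simp
  have "(\<integral>\<^sup>+x. ennreal (p P x) \<partial>mu) = emeasure (density mu (\<lambda>x. ennreal (p P x))) (space mu)"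
    using density_borel[OF P] by (subst emeasure_density) (auto intro!: nn_integral_cong)
  also have "\<dots> = emeasure P (space P)" using is_density[OF P] by (metis space_density)
  also have "\<dots> = 1" using model_prob[OF P] by (rule prob_space.emeasure_space_1)
  finally show "(\<integral>\<^sup>+x. ennreal (p P x) \<partial>mu) = ennreal 1" by simp
qed

lemma hellinger_integrable:
  assumes P: "P \<in> space prior" and Q: "Q \<in> space prior"
  shows "integrable mu (\<lambda>x. (sqrt (p P x) - sqrt (p Q x))\<^sup>2)"
proof (rule Bochner_Integration.integrable_bound)
  note [measurable] = density_borel[OF P] density_borel[OF Q]
  show "integrable mu (\<lambda>x. p P x + p Q x)" using density_integrable P Q by simp
  show "(\<lambda>x. (sqrt (p P x) - sqrt (p Q x))\<^sup>2) \<in> borel_measurable mu" by simp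
  show "AE x in mu. norm ((sqrt (p P x) - sqrt (p Q x))\<^sup>2) \<le> norm (p P x + p Q x)"
  proof (rule AE_I2)
    fix x assume "x \<in> space mu"
    then have nn: "0 \<le> p P x" "0 \<le> p Q x" using density_nonneg P Q by auto
    then have "(sqrt (p P x) - sqrt (p Q x))\<^sup>2 \<le> p P x + p Q x" by (simp add: power2_diff)
    then show "norm ((sqrt (p P x) - sqrt (p Q x))\<^sup>2) \<le> norm (p P x + p Q x)" using nn by simp
  qed
qed

sublocale hellinger: Metric_space "space prior" "hellinger mu p"
proof
  show "0 \<le> hellinger mu p P Q" for P Q by (simp add: hellinger_def)
  show "hellinger mu p P Q = hellinger mu p Q P" for P Q
    by (simp add: hellinger_def power2_commute)
next
  fix P Q assume P: "P \<in> space prior" and Q: "Q \<in> space prior"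
  note [measurable] = density_borel[OF P] density_borel[OF Q]
  show "hellinger mu p P Q = 0 \<longleftrightarrow> P = Q"
  proof
    assume "hellinger mu p P Q = 0"
    then have "AE x in mu. (sqrt (p P x) - sqrt (p Q x))\<^sup>2 = 0"
      using integral_nonneg_eq_0_iff_AE[OF hellinger_integrable[OF P Q]] by (simp add: hellinger_def)
    then have "AE x in mu. ennreal (p P x) = ennreal (p Q x)" by eventually_elim simp
    then have "density mu (\<lambda>x. ennreal (p P x)) = density mu (\<lambda>x. ennreal (p Q x))"
      by (intro density_cong) simp_all
    then show "P = Q" using is_density P Q by simp
  qed (simp add: hellinger_def)
next
  fix P Q R assume P: "P \<in> space prior" and Q: "Q \<in> space prior" and R: "R \<in> space prior"
  note [measurable] = density_borel[OF P] density_borel[OF Q] density_borel[OF R]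
  show "hellinger mu p P R \<le> hellinger mu p P Q + hellinger mu p Q R"
    using sqrt_integral_square_triangle[OF _ _ hellinger_integrable[OF P Q] hellinger_integrable[OF Q R]]
    by (simp add: hellinger_def)
qed

end

end

theory Submission
  imports Defs
begin

text \<open>
  Bound the expected square root of the posterior mass. For \<open>Q\<close> close to \<open>P\<^sub>0\<close> and a mixture \<open>m\<close> over a
  small Hellinger ball away from \<open>P\<^sub>0\<close>, \<open>\<integral> p\<^sub>0 \<surd>(m/q) d\<mu>\<close> is at most some \<open>\<rho> < 1\<close>: it is close to the
  affinity of \<open>P\<^sub>0\<close> and \<open>m\<close> by the second moment condition, and Hellinger balls are stable under mixtures.
  Since \<open>m\<close> is arbitrary, this iterates to \<open>\<rho>\<^sup>n\<close> over \<open>n\<close> observations, and Jensen's inequality on the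
  denominator replaces the marginal likelihood by an average over \<open>Q\<close> near \<open>P\<^sub>0\<close>. Hence the square roots
  of the posterior masses of such a ball are summable almost surely, and finitely many balls cover
  the complement of a neighbourhood of \<open>P\<^sub>0\<close>.
\<close>

section \<open>Square roots, Cauchy-Schwarz and Jensen for extended nonnegative reals\<close>

text \<open>The same case distinction as in \<open>ratio_norm2\<close>, so that this norm unfolds to
  \<open>esqrt\<close> of its second-moment integral.\<close>

definition esqrt :: "ennreal \<Rightarrow> ennreal"
  where "esqrt x = (if x = \<infinity> then \<infinity> else ennreal (sqrt (enn2real x)))"

lemma esqrt_measurable [measurable]: "esqrt \<in> borel_measurable borel"
  unfolding esqrt_def by measurable

lemma esqrt_0 [simp]: "esqrt 0 = 0"
  and esqrt_1 [simp]: "esqrt 1 = 1"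
  and esqrt_top [simp]: "esqrt top = top"
  by (simp_all add: esqrt_def)

lemma esqrt_ennreal [simp]: "0 \<le> x \<Longrightarrow> esqrt (ennreal x) = ennreal (sqrt x)"
  by (simp add: esqrt_def)

lemma esqrt_eq_top_iff [simp]: "esqrt x = top \<longleftrightarrow> x = top"
  by (simp add: esqrt_def)

lemma esqrt_power2 [simp]: "(esqrt x)\<^sup>2 = x"
  by (cases x) (auto simp: ennreal_power power_eq_top_ennreal)

lemma esqrt_of_power2 [simp]: "esqrt (x\<^sup>2) = x"
  by (cases x) (auto simp: ennreal_power power_eq_top_ennreal)

lemma esqrt_mono: "x \<le> y \<Longrightarrow> esqrt x \<le> esqrt y"
  by (cases x; cases y) (auto simp: top_unique)

lemma le_esqrtI: "x\<^sup>2 \<le> y \<Longrightarrow> x \<le> esqrt y"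
  using esqrt_mono[of "x\<^sup>2" y] by simp

text \<open>Squaring is inverse to \<open>esqrt\<close> on all of \<open>ennreal\<close>, so
  equality of the squares suffices and products such as \<open>0 * top\<close> need no separate
  case.\<close>

lemma esqrt_mult: "esqrt (x * y) = esqrt x * esqrt y"
proof -
  have "esqrt (x * y) = esqrt ((esqrt x * esqrt y)\<^sup>2)" by (simp add: power_mult_distrib)
  then show ?thesis by (simp only: esqrt_of_power2)
qed

lemma esqrt_inverse: "esqrt (inverse x) = inverse (esqrt x)"
proof -
  have "esqrt (inverse x) = esqrt ((inverse (esqrt x))\<^sup>2)"
    by (simp flip: ennreal_inverse_power)
  then show ?thesis by (simp only: esqrt_of_power2)
qed

lemma nn_integral_mult_le_esqrt:
  assumes [measurable]: "f \<in> borel_measurable M" "g \<in> borel_measurable M"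
  shows "(\<integral>\<^sup>+x. f x * g x \<partial>M) \<le> esqrt (\<integral>\<^sup>+x. (f x)\<^sup>2 \<partial>M) * esqrt (\<integral>\<^sup>+x. (g x)\<^sup>2 \<partial>M)"
  using Cauchy_Schwarz_nn_integral[of f M g] by (auto intro!: le_esqrtI simp flip: esqrt_mult)

text \<open>Jensen's inequality for the convex function \<open>y \<mapsto> y\<^bsup>-1/2\<^esup>\<close>, through its tangent at the mean.\<close>

lemma inverse_sqrt_tangent:
  fixes m :: real and y :: ennreal
  assumes m: "m > 0"
  shows "ennreal (3 / (2 * sqrt m)) \<le> inverse (esqrt y) + y * ennreal (1 / (2 * (sqrt m)^3))"
\<comment> \<open>At \<open>0\<close> the reciprocal is infinite and at \<open>top\<close> the
  linear term is, so only positive real \<open>y\<close> need an argument.\<close>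
proof (cases "y = 0 \<or> y = top")
  case True
  then show ?thesis using m by (auto simp: ennreal_top_mult)
next
  case False
  then obtain r where r: "y = ennreal r" "r > 0"
    by (cases y) (auto simp: ennreal_eq_0_iff)
  define s t where "s = sqrt r" and "t = sqrt m"
  have st: "s > 0" "t > 0" "r = s\<^sup>2" "sqrt m = t" using m r by (auto simp: s_def t_def)
  \<comment> \<open>Multiplied by \<open>2 * s * t^3\<close>, the claim reads
    \<open>3 * s * t^2 \<le> 2 * t^3 + s^3\<close>, and the difference of the two sides is this
    product.\<close>
  have "0 \<le> (s - t)\<^sup>2 * (s + 2 * t)" using st by simp
  then have "3 / (2 * t) \<le> inverse s + s\<^sup>2 * (1 / (2 * t^3))"
    using st by (simp add: field_simps power2_eq_square power3_eq_cube)
  then have "ennreal (3 / (2 * t)) \<le> ennreal (inverse s + s\<^sup>2 * (1 / (2 * t^3)))"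
    by (rule ennreal_leI)
  also have "\<dots> = ennreal (inverse s) + ennreal (s\<^sup>2) * ennreal (1 / (2 * t^3))"
    using st by (simp flip: ennreal_mult)
  finally show ?thesis using st by (simp add: r inverse_ennreal)
qed

text \<open>After division of the measure by its mass \<open>b\<close>, the mean of \<open>y\<close>
  is its integral over \<open>b\<close>; undoing this normalisation in Jensen's inequality leaves
  the factor \<open>b * sqrt b\<close>.\<close>

lemma jensen_inverse_esqrt:
  assumes [measurable]: "y \<in> borel_measurable M"
    and b: "emeasure M (space M) = ennreal b" "b > 0"
  shows "ennreal (b * sqrt b) * inverse (esqrt (\<integral>\<^sup>+x. y x \<partial>M)) \<le> (\<integral>\<^sup>+x. inverse (esqrt (y x)) \<partial>M)"
proof -
  let ?W = "\<integral>\<^sup>+x. inverse (esqrt (y x)) \<partial>M" and ?D = "\<integral>\<^sup>+x. y x \<partial>M"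
  have tangent: "ennreal (3 / (2 * sqrt m) * b) \<le> ?W + ?D * ennreal (1 / (2 * (sqrt m)^3))"
    if m: "m > 0" for m
  proof -
    have "ennreal (3 / (2 * sqrt m) * b) = (\<integral>\<^sup>+x. ennreal (3 / (2 * sqrt m)) \<partial>M)"
      using b m by (simp flip: ennreal_mult)
    also have "\<dots> \<le> (\<integral>\<^sup>+x. inverse (esqrt (y x)) + y x * ennreal (1 / (2 * (sqrt m)^3)) \<partial>M)"
      by (intro nn_integral_mono inverse_sqrt_tangent m)
    also have "\<dots> = ?W + ?D * ennreal (1 / (2 * (sqrt m)^3))"
      by (subst nn_integral_add) (auto simp: nn_integral_multc)
    finally show ?thesis .
  qed
  consider "?D = top" | "?D = 0" | d where "?D = ennreal d" "d > 0"
    by (cases ?D) (auto simp: ennreal_eq_0_iff less_le)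
  then show ?thesis
  proof cases
    case 1 then show ?thesis by simp
  next
    case 2
    \<comment> \<open>\<open>y\<close> vanishes almost everywhere, so the right-hand integrand is
      infinite on a space of positive mass.\<close>
    have "AE x in M. y x = 0" using 2 by (simp add: nn_integral_0_iff_AE)
    then have "?W = (\<integral>\<^sup>+x. top \<partial>M)" by (intro nn_integral_cong_AE) auto
    then show ?thesis using b by (simp add: ennreal_top_mult)
  next
    case 3
    define s t where "s = sqrt b" and "t = sqrt d"
    have st: "s > 0" "t > 0" "b = s\<^sup>2" "d = t\<^sup>2" using b 3 by (auto simp: s_def t_def)
    have "ennreal (3 / (2 * sqrt (d / b)) * b) \<le> ?W + ?D * ennreal (1 / (2 * (sqrt (d / b))^3))"
      using b 3 by (intro tangent) simp
    also have "?D * ennreal (1 / (2 * (sqrt (d / b))^3)) = ennreal (d * (1 / (2 * (sqrt (d / b))^3)))"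
      using b 3 by (simp flip: ennreal_mult)
    also have "sqrt (d / b) = t / s" using st by (simp add: real_sqrt_divide)
    finally have le: "ennreal (3 / (2 * (t / s)) * b) \<le> ?W + ennreal (d * (1 / (2 * (t / s)^3)))" .
    have eq: "b * sqrt b * inverse t = 3 / (2 * (t / s)) * b - d * (1 / (2 * (t / s)^3))"
      using st by (simp add: field_simps power2_eq_square power3_eq_cube)
    have "ennreal (b * sqrt b) * inverse (esqrt ?D) = ennreal (b * sqrt b * inverse t)"
      using st by (simp add: 3 inverse_ennreal ennreal_mult)
    also have "\<dots> = ennreal (3 / (2 * (t / s)) * b) - ennreal (d * (1 / (2 * (t / s)^3)))"
      unfolding eq using st by (subst ennreal_minus) simp_all
    also have "\<dots> \<le> ?W"
      using le by (simp add: ennreal_minus_le_iff add.commute)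
    finally show ?thesis .
  qed
qed

section \<open>Affinities of root densities and of mixtures\<close>

text \<open>Expanding the square of \<open>a - b\<close> trades inner products for distances. Stated
  for arbitrary unit vectors of L2 because it also serves for the root of a mixture, which need not
  be a model density.\<close>

lemma unit_affinity:
  fixes a b :: "'a \<Rightarrow> real"
  assumes [measurable]: "a \<in> borel_measurable M" "b \<in> borel_measurable M"
    and ia: "integrable M (\<lambda>x. (a x)\<^sup>2)" and ib: "integrable M (\<lambda>x. (b x)\<^sup>2)"
    and unit: "(\<integral>x. (a x)\<^sup>2 \<partial>M) = 1" "(\<integral>x. (b x)\<^sup>2 \<partial>M) = 1"
  shows "integrable M (\<lambda>x. a x * b x)"
    and "(\<integral>x. a x * b x \<partial>M) = 1 - (\<integral>x. (a x - b x)\<^sup>2 \<partial>M) / 2"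
    and "integrable M (\<lambda>x. (a x - b x)\<^sup>2)"
proof -
  show iab: "integrable M (\<lambda>x. a x * b x)"
  proof (rule Bochner_Integration.integrable_bound)
    show "integrable M (\<lambda>x. (a x)\<^sup>2 + (b x)\<^sup>2)" using ia ib by simp
    have "\<bar>u * v\<bar> \<le> u\<^sup>2 + v\<^sup>2" for u v :: real
      using sum_squares_bound[of "\<bar>u\<bar>" "\<bar>v\<bar>"] abs_ge_zero[of "u * v"]
      unfolding abs_mult mult.assoc power2_abs by linarith
    then show "AE x in M. norm (a x * b x) \<le> norm ((a x)\<^sup>2 + (b x)\<^sup>2)" by simp
  qed simp
  have expand: "(\<lambda>x. (a x - b x)\<^sup>2) = (\<lambda>x. (a x)\<^sup>2 + (b x)\<^sup>2 - 2 * (a x * b x))"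
    by (simp add: power2_eq_square algebra_simps)
  show "integrable M (\<lambda>x. (a x - b x)\<^sup>2)" using ia ib iab by (simp add: expand)
  show "(\<integral>x. a x * b x \<partial>M) = 1 - (\<integral>x. (a x - b x)\<^sup>2 \<partial>M) / 2"
    using ia ib iab by (simp add: expand unit diff_divide_distrib)
qed

context dominated_model
begin

lemma measurable_density [measurable (raw)]:
  assumes "f \<in> M \<rightarrow>\<^sub>M mu" "g \<in> M \<rightarrow>\<^sub>M prior"
  shows "(\<lambda>w. p (g w) (f w)) \<in> borel_measurable M"
  using measurable_compose[OF measurable_Pair[OF assms] density_measurable] by simp

lemma sets_model: "P \<in> space prior \<Longrightarrow> sets P = sets mu"
  using is_density sets_density by metis

lemma nn_integral_density_eq_1:
  assumes P: "P \<in> space prior"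
  shows "(\<integral>\<^sup>+x. ennreal (p P x) \<partial>mu) = 1"
proof -
  have "(\<integral>\<^sup>+x. ennreal (p P x) \<partial>mu) = emeasure (density mu (\<lambda>x. ennreal (p P x))) (space mu)"
    using density_borel[OF P] by (subst emeasure_density) (auto intro!: nn_integral_cong)
  also have "\<dots> = emeasure P (space P)" using is_density[OF P] by (metis space_density)
  also have "\<dots> = 1" using model_prob[OF P] by (rule prob_space.emeasure_space_1)
  finally show ?thesis .
qed

lemma integral_sqrt_density_power2:
  assumes P: "P \<in> space prior"
  shows "integrable mu (\<lambda>x. (sqrt (p P x))\<^sup>2)" "(\<integral>x. (sqrt (p P x))\<^sup>2 \<partial>mu) = 1"
proof -
  note [measurable] = density_borel[OF P]
  show "integrable mu (\<lambda>x. (sqrt (p P x))\<^sup>2)"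
    using density_integrable[OF P] density_nonneg[OF P]
    by (subst Bochner_Integration.integrable_cong[OF refl, where g = "p P"]) auto
  have "(\<integral>x. (sqrt (p P x))\<^sup>2 \<partial>mu) = (\<integral>x. p P x \<partial>mu)"
    using density_nonneg[OF P] by (intro Bochner_Integration.integral_cong) auto
  also have "\<dots> = enn2real (\<integral>\<^sup>+x. ennreal (p P x) \<partial>mu)"
    using density_nonneg[OF P] by (intro integral_eq_nn_integral) auto
  finally show "(\<integral>x. (sqrt (p P x))\<^sup>2 \<partial>mu) = 1" by (simp add: nn_integral_density_eq_1[OF P])
qed

lemma hellinger_power2: "(hellinger mu p P Q)\<^sup>2 = (\<integral>x. (sqrt (p P x) - sqrt (p Q x))\<^sup>2 \<partial>mu)"
  by (simp add: hellinger_def)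

text \<open>The polarisation identity for root densities, written in \<open>ennreal\<close> so that
  it can be integrated over the model by Tonelli.\<close>

lemma nn_integral_affinity:
  assumes P: "P \<in> space prior" and Q: "Q \<in> space prior"
  shows "(\<integral>\<^sup>+x. esqrt (ennreal (p P x)) * esqrt (ennreal (p Q x)) \<partial>mu)
    = ennreal (1 - (hellinger mu p P Q)\<^sup>2 / 2)"
proof -
  note [measurable] = density_borel[OF P] density_borel[OF Q]
  note aff = unit_affinity[of "\<lambda>x. sqrt (p P x)" mu "\<lambda>x. sqrt (p Q x)", OF _ _
      integral_sqrt_density_power2(1)[OF P] integral_sqrt_density_power2(1)[OF Q]
      integral_sqrt_density_power2(2)[OF P] integral_sqrt_density_power2(2)[OF Q]]
  have "(\<integral>\<^sup>+x. esqrt (ennreal (p P x)) * esqrt (ennreal (p Q x)) \<partial>mu)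
      = (\<integral>\<^sup>+x. ennreal (sqrt (p P x) * sqrt (p Q x)) \<partial>mu)"
    using density_nonneg[OF P] density_nonneg[OF Q]
    by (intro nn_integral_cong) (simp add: ennreal_mult)
  also have "\<dots> = ennreal (\<integral>x. sqrt (p P x) * sqrt (p Q x) \<partial>mu)"
    using density_nonneg[OF P] density_nonneg[OF Q] aff(1)
    by (intro nn_integral_eq_integral) auto
  also have "\<dots> = ennreal (1 - (hellinger mu p P Q)\<^sup>2 / 2)"
    using aff(2) by (simp add: hellinger_power2)
  finally show ?thesis .
qed

text \<open>Tonelli's theorem, for an arbitrary finite \<open>\<nu>\<close> because the induction
  over the sample leaves the class of probability measures.\<close>

lemma nn_integral_mixture:
  assumes fin: "finite_measure \<nu>" and sets [measurable_cong]: "sets \<nu> = sets prior"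
    and [measurable]: "(f :: 'a \<Rightarrow> ennreal) \<in> borel_measurable mu"
      "(\<lambda>(x, P). h P x) \<in> borel_measurable (mu \<Otimes>\<^sub>M prior)"
  shows "(\<integral>\<^sup>+x. f x * (\<integral>\<^sup>+P. h P x \<partial>\<nu>) \<partial>mu) = (\<integral>\<^sup>+P. (\<integral>\<^sup>+x. f x * h P x \<partial>mu) \<partial>\<nu>)"
proof -
  interpret nu: finite_measure \<nu> by (rule fin)
  interpret pair: pair_sigma_finite mu \<nu> ..
  have "(\<integral>\<^sup>+x. f x * (\<integral>\<^sup>+P. h P x \<partial>\<nu>) \<partial>mu) = (\<integral>\<^sup>+x. (\<integral>\<^sup>+P. f x * h P x \<partial>\<nu>) \<partial>mu)"
    by (intro nn_integral_cong nn_integral_cmult[symmetric]) measurable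
  also have "\<dots> = (\<integral>\<^sup>+P. (\<integral>\<^sup>+x. f x * h P x \<partial>mu) \<partial>\<nu>)"
    by (rule pair.Fubini'[symmetric]) measurable
  finally show ?thesis .
qed

lemma nn_integral_mixture_density:
  assumes fin: "finite_measure \<nu>" and sets [measurable_cong]: "sets \<nu> = sets prior"
  shows "(\<integral>\<^sup>+x. (\<integral>\<^sup>+P. ennreal (p P x) \<partial>\<nu>) \<partial>mu) = emeasure \<nu> (space \<nu>)"
proof -
  have "(\<integral>\<^sup>+x. (\<integral>\<^sup>+P. ennreal (p P x) \<partial>\<nu>) \<partial>mu) = (\<integral>\<^sup>+P. (\<integral>\<^sup>+x. ennreal (p P x) \<partial>mu) \<partial>\<nu>)"
    using nn_integral_mixture[OF assms, of "\<lambda>_. 1" "\<lambda>P x. ennreal (p P x)"] by simp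
  also have "\<dots> = (\<integral>\<^sup>+P. 1 \<partial>\<nu>)"
    using sets_eq_imp_space_eq[OF sets] by (intro nn_integral_cong) (simp add: nn_integral_density_eq_1)
  finally show ?thesis by simp
qed


text \<open>The root of the mixture, normalised, lies within \<open>d\<close> of the root density of
  \<open>K\<close>; the triangle inequality then keeps it at distance at least \<open>e\<close> from
  that of \<open>P0\<close>. The root of the total mass undoes the normalisation.\<close>

lemma mixture_affinity:
  assumes fin: "finite_measure \<nu>" and sets [measurable_cong]: "sets \<nu> = sets prior"
    and K: "K \<in> space prior" and P0: "P0 \<in> space prior" and "0 \<le> d" "0 \<le> e"
    and near: "AE P in \<nu>. hellinger mu p P K \<le> d" and far: "d + e \<le> hellinger mu p K P0"
  shows "(\<integral>\<^sup>+x. esqrt (ennreal (p P0 x)) * esqrt (\<integral>\<^sup>+P. ennreal (p P x) \<partial>\<nu>) \<partial>mu)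
    \<le> ennreal (1 - e\<^sup>2 / 2) * esqrt (emeasure \<nu> (space \<nu>))"
proof -
  interpret nu: finite_measure \<nu> by (rule fin)
  note [measurable] = density_borel[OF K] density_borel[OF P0]
  have space: "space \<nu> = space prior" using sets by (rule sets_eq_imp_space_eq)
  define m where "m x = (\<integral>\<^sup>+P. ennreal (p P x) \<partial>\<nu>)" for x
  have m [measurable]: "m \<in> borel_measurable mu" unfolding m_def by measurable
  define c where "c = measure \<nu> (space \<nu>)"
  have c: "emeasure \<nu> (space \<nu>) = ennreal c" "c \<ge> 0"
    by (simp_all add: c_def nu.emeasure_eq_measure)
  have int_m: "(\<integral>\<^sup>+x. m x \<partial>mu) = ennreal c"
    unfolding m_def using nn_integral_mixture_density[OF fin sets] c by simp
  show ?thesis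
  proof (cases "c = 0")
    case True
    then have "AE x in mu. m x = 0" using int_m by (simp add: nn_integral_0_iff_AE)
    then have "(\<integral>\<^sup>+x. esqrt (ennreal (p P0 x)) * esqrt (m x) \<partial>mu) = (\<integral>\<^sup>+x. 0 \<partial>mu)"
      by (intro nn_integral_cong_AE) auto
    then show ?thesis by (simp add: m_def)
  next
    case False
    then have c0: "c > 0" using c by simp
    \<comment> \<open>\<open>g\<close> is the root density of the normalised mixture; replacing
      \<open>m x\<close> by a real is harmless because \<open>m\<close> is finite almost
      everywhere.\<close>
    define a b g where "a x = sqrt (p P0 x)" and "b x = sqrt (p K x)"
      and "g x = sqrt (enn2real (m x) / c)" for x
    have [measurable]: "a \<in> borel_measurable mu" "b \<in> borel_measurable mu" "g \<in> borel_measurable mu"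
      unfolding a_def b_def g_def by measurable
    have g0: "g x \<ge> 0" for x using c0 by (simp add: g_def)
    have fin_m: "AE x in mu. m x \<noteq> top" using nn_integral_noteq_infinite[OF m] int_m by simp
    have mg: "AE x in mu. m x = ennreal (c * (g x)\<^sup>2)"
      using fin_m by eventually_elim (use c0 in \<open>simp add: g_def ennreal_enn2real_if\<close>)
    have "ennreal c * (\<integral>\<^sup>+x. ennreal ((g x)\<^sup>2) \<partial>mu) = (\<integral>\<^sup>+x. m x \<partial>mu)"
      using mg c0 by (subst nn_integral_cmult[symmetric])
        (auto intro!: nn_integral_cong_AE simp: ennreal_mult)
    then have "ennreal c * (\<integral>\<^sup>+x. ennreal ((g x)\<^sup>2) \<partial>mu) = ennreal c * 1" by (simp add: int_m)
    then have int_g2: "(\<integral>\<^sup>+x. ennreal ((g x)\<^sup>2) \<partial>mu) = 1"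
      using c0 by (subst (asm) ennreal_mult_cancel_left) auto
    have ig: "integrable mu (\<lambda>x. (g x)\<^sup>2)"
      by (rule integrableI_nn_integral_finite[where x = 1]) (auto simp: int_g2)
    have ug: "(\<integral>x. (g x)\<^sup>2 \<partial>mu) = 1"
      by (subst integral_eq_nn_integral) (auto simp: int_g2)
    have ia: "integrable mu (\<lambda>x. (a x)\<^sup>2)" "(\<integral>x. (a x)\<^sup>2 \<partial>mu) = 1"
      and ib: "integrable mu (\<lambda>x. (b x)\<^sup>2)" "(\<integral>x. (b x)\<^sup>2 \<partial>mu) = 1"
      unfolding a_def b_def using integral_sqrt_density_power2 K P0 by auto
    note bg = unit_affinity[of b mu g, OF _ _ ib(1) ig ib(2) ug]
    note ag = unit_affinity[of a mu g, OF _ _ ia(1) ig ia(2) ug]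
    have a0: "AE x in mu. 0 \<le> a x" and b0: "AE x in mu. 0 \<le> b x"
      using density_nonneg K P0 by (auto simp: a_def b_def)
    text \<open>Concavity of the square root keeps the normalised mixture in the Hellinger ball around \<open>K\<close>.\<close>
    have "ennreal (1 - d\<^sup>2 / 2) * ennreal c = (\<integral>\<^sup>+P. ennreal (1 - d\<^sup>2 / 2) \<partial>\<nu>)"
      using c by simp
    also have "\<dots> \<le> (\<integral>\<^sup>+P. (\<integral>\<^sup>+x. esqrt (ennreal (p K x)) * esqrt (ennreal (p P x)) \<partial>mu) \<partial>\<nu>)"
    proof (rule nn_integral_mono_AE)
      show "AE P in \<nu>. ennreal (1 - d\<^sup>2 / 2)
          \<le> (\<integral>\<^sup>+x. esqrt (ennreal (p K x)) * esqrt (ennreal (p P x)) \<partial>mu)"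
        using near AE_space
      proof eventually_elim
        case (elim P)
        then have "(hellinger mu p K P)\<^sup>2 \<le> d\<^sup>2"
          using hellinger.commute[of K P] by (intro power_mono) auto
        then show ?case
          using elim K by (subst nn_integral_affinity) (auto simp: space intro!: ennreal_leI)
      qed
    qed
    also have "\<dots> = (\<integral>\<^sup>+x. esqrt (ennreal (p K x)) * (\<integral>\<^sup>+P. esqrt (ennreal (p P x)) \<partial>\<nu>) \<partial>mu)"
      by (rule nn_integral_mixture[OF fin sets, symmetric]) measurable
    also have "\<dots> \<le> (\<integral>\<^sup>+x. ennreal c * ennreal (b x * g x) \<partial>mu)"
    proof (rule nn_integral_mono_AE)
      show "AE x in mu. esqrt (ennreal (p K x)) * (\<integral>\<^sup>+P. esqrt (ennreal (p P x)) \<partial>\<nu>)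
          \<le> ennreal c * ennreal (b x * g x)"
        using mg b0 AE_space
      proof eventually_elim
        case (elim x)
        have [measurable]: "(\<lambda>P. p P x) \<in> borel_measurable \<nu>" using elim by measurable
        \<comment> \<open>Cauchy-Schwarz against the constant \<open>1\<close> is the concavity of
          the root, for a measure of mass \<open>c\<close>.\<close>
        have "(\<integral>\<^sup>+P. esqrt (ennreal (p P x)) \<partial>\<nu>) \<le> esqrt (m x) * esqrt (ennreal c)"
          using nn_integral_mult_le_esqrt[of "\<lambda>P. esqrt (ennreal (p P x))" \<nu> "\<lambda>_. 1"]
          by (simp add: m_def c)
        also have "\<dots> = ennreal (c * g x)"
          using elim c0 g0[of x] by (simp add: real_sqrt_mult flip: ennreal_mult)
        finally have "esqrt (ennreal (p K x)) * (\<integral>\<^sup>+P. esqrt (ennreal (p P x)) \<partial>\<nu>)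
            \<le> ennreal (b x) * ennreal (c * g x)"
          using density_nonneg[OF K, of x] elim by (intro mult_mono) (auto simp: b_def)
        also have "\<dots> = ennreal c * ennreal (b x * g x)"
          using elim c0 g0[of x] by (simp add: mult_ac flip: ennreal_mult)
        finally show ?case .
      qed
    qed
    also have "\<dots> = ennreal c * ennreal (\<integral>x. b x * g x \<partial>mu)"
      using b0 g0 bg(1) by (subst nn_integral_cmult) (auto intro!: arg_cong2[where f = "(*)"]
        nn_integral_eq_integral)
    finally have "ennreal c * ennreal (1 - d\<^sup>2 / 2) \<le> ennreal c * ennreal (\<integral>x. b x * g x \<partial>mu)"
      by (simp add: mult.commute)
    then have "ennreal (1 - d\<^sup>2 / 2) \<le> ennreal (\<integral>x. b x * g x \<partial>mu)"
      using c0 by (subst (asm) ennreal_mult_le_mult_iff) auto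
    \<comment> \<open>\<open>ennreal\<close> sends a negative \<open>1 - d\<^sup>2 / 2\<close> to
      \<open>0\<close>; nonnegativity of the integral lets the inequality return to the reals in
      that case too.\<close>
    moreover have "0 \<le> (\<integral>x. b x * g x \<partial>mu)" using b0 g0 by (intro integral_nonneg_AE) auto
    ultimately have "1 - d\<^sup>2 / 2 \<le> (\<integral>x. b x * g x \<partial>mu)"
      by (simp only: ennreal_le_iff)
    then have "(\<integral>x. (b x - g x)\<^sup>2 \<partial>mu) \<le> d\<^sup>2" using bg(2) by simp
    then have bg_le: "sqrt (\<integral>x. (b x - g x)\<^sup>2 \<partial>mu) \<le> d" using \<open>0 \<le> d\<close> by (rule real_le_lsqrt[rotated])
    \<comment> \<open>The mixture need not belong to the model, so the triangle inequality is that
      of L2, passing through \<open>g\<close>.\<close>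
    have "hellinger mu p K P0 = sqrt (\<integral>x. ((b x - g x) + (g x - a x))\<^sup>2 \<partial>mu)"
      by (simp add: hellinger_def a_def b_def)
    also have "\<dots> \<le> sqrt (\<integral>x. (b x - g x)\<^sup>2 \<partial>mu) + sqrt (\<integral>x. (g x - a x)\<^sup>2 \<partial>mu)"
      using bg(3) ag(3) by (intro sqrt_integral_square_triangle) (auto simp: power2_commute)
    finally have "e \<le> sqrt (\<integral>x. (a x - g x)\<^sup>2 \<partial>mu)"
      using far bg_le by (simp add: power2_commute)
    then have "e\<^sup>2 \<le> (\<integral>x. (a x - g x)\<^sup>2 \<partial>mu)"
      using \<open>0 \<le> e\<close> power_mono[of e _ 2] by fastforce
    then have ag_le: "(\<integral>x. a x * g x \<partial>mu) \<le> 1 - e\<^sup>2 / 2" using ag(2) by simp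
    have "(\<integral>\<^sup>+x. esqrt (ennreal (p P0 x)) * esqrt (m x) \<partial>mu)
        = (\<integral>\<^sup>+x. ennreal (sqrt c) * ennreal (a x * g x) \<partial>mu)"
    proof (rule nn_integral_cong_AE)
      show "AE x in mu. esqrt (ennreal (p P0 x)) * esqrt (m x) = ennreal (sqrt c) * ennreal (a x * g x)"
        using mg a0 AE_space
      proof eventually_elim
        case (elim x)
        then show ?case using density_nonneg[OF P0, of x] c0 g0[of x]
          by (simp add: real_sqrt_mult a_def mult_ac flip: ennreal_mult)
      qed
    qed
    also have "\<dots> = ennreal (sqrt c) * ennreal (\<integral>x. a x * g x \<partial>mu)"
      using a0 g0 ag(1) by (subst nn_integral_cmult) (auto intro!: arg_cong2[where f = "(*)"]
        nn_integral_eq_integral)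
    also have "\<dots> \<le> ennreal (sqrt c) * ennreal (1 - e\<^sup>2 / 2)"
      by (intro mult_left_mono ennreal_leI ag_le) simp
    finally show ?thesis using c by (simp add: m_def mult.commute)
  qed
qed

text \<open>With \<open>p\<^sub>0 / \<surd>q = \<surd>p\<^sub>0 + (\<surd>p\<^sub>0 - \<surd>q) \<surd>(p\<^sub>0 / q)\<close>, replacing \<open>q\<close> by \<open>p\<^sub>0\<close> costs at most the
  Hellinger distance times \<open>L\<close>.\<close>

lemma mixture_likelihood_ratio:
  assumes fin: "finite_measure \<nu>" and sets [measurable_cong]: "sets \<nu> = sets prior"
    and K: "K \<in> space prior" and P0: "P0 \<in> space prior" and Q: "Q \<in> space prior"
    and "0 \<le> d" "0 \<le> e" "0 \<le> L"
    and near: "AE P in \<nu>. hellinger mu p P K \<le> d" and far: "d + e \<le> hellinger mu p K P0"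
    and ratio: "\<And>P. P \<in> space prior \<Longrightarrow> (\<integral>\<^sup>+x. (ennreal (p P x))\<^sup>2 / ennreal (p Q x) \<partial>mu) \<le> ennreal (L\<^sup>2)"
  shows "(\<integral>\<^sup>+x. esqrt (\<integral>\<^sup>+P. ennreal (p P x) \<partial>\<nu>) * inverse (esqrt (ennreal (p Q x))) \<partial>P0)
    \<le> (ennreal (1 - e\<^sup>2 / 2) + ennreal (hellinger mu p P0 Q * L)) * esqrt (emeasure \<nu> (space \<nu>))"
proof -
  interpret nu: finite_measure \<nu> by (rule fin)
  note [measurable] = density_borel[OF Q] density_borel[OF P0]
  have space: "space \<nu> = space prior" using sets by (rule sets_eq_imp_space_eq)
  define m where "m x = (\<integral>\<^sup>+P. ennreal (p P x) \<partial>\<nu>)" for x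
  have m [measurable]: "m \<in> borel_measurable mu" unfolding m_def by measurable
  let ?p0 = "\<lambda>x. ennreal (p P0 x)" and ?q = "\<lambda>x. ennreal (p Q x)"
  \<comment> \<open>The convention \<open>a / 0 = \<infinity>\<close> for \<open>a > 0\<close> turns
    finiteness of the second moment into positivity of \<open>p Q x\<close> where
    \<open>p P0 x\<close> is positive.\<close>
  have pos: "AE x in mu. p P0 x \<noteq> 0 \<longrightarrow> p Q x \<noteq> 0"
  proof -
    have "(\<integral>\<^sup>+x. (?p0 x)\<^sup>2 / ?q x \<partial>mu) \<noteq> \<infinity>"
      using ratio[OF P0] by (auto simp: top_unique)
    then have "AE x in mu. (?p0 x)\<^sup>2 / ?q x \<noteq> \<infinity>" by (intro nn_integral_noteq_infinite) simp_all
    then show ?thesis using AE_space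
    proof eventually_elim
      case (elim x)
      then show ?case using density_nonneg[OF P0, of x]
        by (auto simp: divide_ennreal_def ennreal_mult_top power_eq_0_iff ennreal_eq_0_iff)
    qed
  qed
  \<comment> \<open>\<open>2 * u * v \<le> u^2 + v^2\<close> bounds the mixed moment by the second
    moments of \<open>P0\<close> and \<open>P\<close>, both controlled by
    \<open>ratio\<close>.\<close>
  have cross: "(\<integral>\<^sup>+x. ?p0 x * ennreal (p P x) * inverse (?q x) \<partial>mu) \<le> ennreal (L\<^sup>2)"
    if P: "P \<in> space prior" for P
  proof -
    note [measurable] = density_borel[OF P]
    have "2 * (\<integral>\<^sup>+x. ?p0 x * ennreal (p P x) * inverse (?q x) \<partial>mu)
        = (\<integral>\<^sup>+x. 2 * ?p0 x * ennreal (p P x) * inverse (?q x) \<partial>mu)"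
      by (subst nn_integral_cmult[symmetric]) (auto simp: mult.assoc)
    also have "\<dots> \<le> (\<integral>\<^sup>+x. ((?p0 x)\<^sup>2 + (ennreal (p P x))\<^sup>2) * inverse (?q x) \<partial>mu)"
      by (intro nn_integral_mono mult_right_mono sum_of_squares_ge_ennreal) simp
    also have "\<dots> = (\<integral>\<^sup>+x. (?p0 x)\<^sup>2 / ?q x \<partial>mu) + (\<integral>\<^sup>+x. (ennreal (p P x))\<^sup>2 / ?q x \<partial>mu)"
      by (subst nn_integral_add[symmetric]) (auto simp: divide_ennreal_def distrib_right)
    also have "\<dots> \<le> ennreal (L\<^sup>2) + ennreal (L\<^sup>2)" by (intro add_mono ratio P P0)
    also have "\<dots> = 2 * ennreal (L\<^sup>2)" by (simp add: mult_2)
    finally show ?thesis by (subst (asm) ennreal_mult_le_mult_iff) auto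
  qed
  have "(\<integral>\<^sup>+x. (?p0 x * inverse (?q x)) * m x \<partial>mu)
      = (\<integral>\<^sup>+P. (\<integral>\<^sup>+x. (?p0 x * inverse (?q x)) * ennreal (p P x) \<partial>mu) \<partial>\<nu>)"
    unfolding m_def by (rule nn_integral_mixture[OF fin sets]) measurable
  also have "\<dots> \<le> (\<integral>\<^sup>+P. ennreal (L\<^sup>2) \<partial>\<nu>)"
    using cross by (intro nn_integral_mono) (simp add: space mult_ac)
  also have "\<dots> = ennreal (L\<^sup>2) * emeasure \<nu> (space \<nu>)" by simp
  finally have int_w: "(\<integral>\<^sup>+x. (?p0 x * inverse (?q x)) * m x \<partial>mu) \<le> ennreal (L\<^sup>2) * emeasure \<nu> (space \<nu>)" .
  have "(\<integral>\<^sup>+x. esqrt (m x) * inverse (esqrt (?q x)) \<partial>P0)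
      = (\<integral>\<^sup>+x. ?p0 x * (esqrt (m x) * inverse (esqrt (?q x))) \<partial>mu)"
    by (subst is_density[OF P0, symmetric], subst nn_integral_density) auto
  also have "\<dots> \<le> (\<integral>\<^sup>+x. esqrt (?p0 x) * esqrt (m x)
      + ennreal \<bar>sqrt (p P0 x) - sqrt (p Q x)\<bar> * esqrt ((?p0 x * inverse (?q x)) * m x) \<partial>mu)"
  proof (rule nn_integral_mono_AE)
    show "AE x in mu. ?p0 x * (esqrt (m x) * inverse (esqrt (?q x)))
      \<le> esqrt (?p0 x) * esqrt (m x)
        + ennreal \<bar>sqrt (p P0 x) - sqrt (p Q x)\<bar> * esqrt ((?p0 x * inverse (?q x)) * m x)"
      using pos AE_space
    proof eventually_elim
      case (elim x)
      have nn: "0 \<le> p P0 x" "0 \<le> p Q x" using elim density_nonneg P0 Q by auto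
      show ?case
      proof (cases "p P0 x = 0")
        case False
        define s t where "s = sqrt (p P0 x)" and "t = sqrt (p Q x)"
        have st: "s > 0" "t > 0" "p P0 x = s\<^sup>2" "p Q x = t\<^sup>2"
          using nn elim False by (auto simp: s_def t_def)
        have "s\<^sup>2 * inverse t \<le> s + \<bar>s - t\<bar> * (s * inverse t)"
        proof -
          have "s\<^sup>2 \<le> (t + \<bar>s - t\<bar>) * s" 
            using st unfolding power2_eq_square by (intro mult_right_mono) auto
          then show ?thesis using st by (simp add: field_simps)
        qed
        then have le: "ennreal (s\<^sup>2) * ennreal (inverse t)
            \<le> ennreal s + ennreal \<bar>s - t\<bar> * (ennreal s * ennreal (inverse t))"
          using st by (simp flip: ennreal_mult ennreal_plus)
        have inv_q: "esqrt (inverse (?q x)) = ennreal (inverse t)"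
          unfolding esqrt_inverse using st by (simp add: inverse_ennreal)
        have "?p0 x * (esqrt (m x) * inverse (esqrt (?q x)))
            = (ennreal (s\<^sup>2) * ennreal (inverse t)) * esqrt (m x)"
          using st by (simp add: inverse_ennreal mult_ac)
        also have "\<dots> \<le> (ennreal s + ennreal \<bar>s - t\<bar> * (ennreal s * ennreal (inverse t))) * esqrt (m x)"
          by (rule mult_right_mono[OF le]) simp
        also have "\<dots> = esqrt (?p0 x) * esqrt (m x)
            + ennreal \<bar>s - t\<bar> * esqrt ((?p0 x * inverse (?q x)) * m x)"
          unfolding esqrt_mult inv_q using st by (simp add: distrib_left mult_ac)
        finally show ?thesis using st by simp
      qed simp
    qed
  qed
  also have "\<dots> = (\<integral>\<^sup>+x. esqrt (?p0 x) * esqrt (m x) \<partial>mu)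
      + (\<integral>\<^sup>+x. ennreal \<bar>sqrt (p P0 x) - sqrt (p Q x)\<bar> * esqrt ((?p0 x * inverse (?q x)) * m x) \<partial>mu)"
    by (rule nn_integral_add) measurable
  also have "\<dots> \<le> ennreal (1 - e\<^sup>2 / 2) * esqrt (emeasure \<nu> (space \<nu>))
      + ennreal (hellinger mu p P0 Q) * (ennreal L * esqrt (emeasure \<nu> (space \<nu>)))"
  proof (rule add_mono)
    show "(\<integral>\<^sup>+x. esqrt (?p0 x) * esqrt (m x) \<partial>mu) \<le> ennreal (1 - e\<^sup>2 / 2) * esqrt (emeasure \<nu> (space \<nu>))"
      unfolding m_def by (rule mixture_affinity[OF fin sets K P0]) fact+
    have "(\<integral>\<^sup>+x. (ennreal \<bar>sqrt (p P0 x) - sqrt (p Q x)\<bar>)\<^sup>2 \<partial>mu) = ennreal ((hellinger mu p P0 Q)\<^sup>2)"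
      unfolding hellinger_power2 using hellinger_integrable[OF P0 Q]
      by (simp add: ennreal_power nn_integral_eq_integral)
    then have H: "esqrt (\<integral>\<^sup>+x. (ennreal \<bar>sqrt (p P0 x) - sqrt (p Q x)\<bar>)\<^sup>2 \<partial>mu) = ennreal (hellinger mu p P0 Q)"
      by simp
    \<comment> \<open>Cauchy-Schwarz separates the Hellinger distance from the moment bounded in
      \<open>int_w\<close>.\<close>
    have "(\<integral>\<^sup>+x. ennreal \<bar>sqrt (p P0 x) - sqrt (p Q x)\<bar> * esqrt ((?p0 x * inverse (?q x)) * m x) \<partial>mu)
        \<le> ennreal (hellinger mu p P0 Q) * esqrt (\<integral>\<^sup>+x. (?p0 x * inverse (?q x)) * m x \<partial>mu)"
      using nn_integral_mult_le_esqrt[of "\<lambda>x. ennreal \<bar>sqrt (p P0 x) - sqrt (p Q x)\<bar>" mu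
          "\<lambda>x. esqrt ((?p0 x * inverse (?q x)) * m x)"]
      unfolding H by simp
    also have "\<dots> \<le> ennreal (hellinger mu p P0 Q) * esqrt (ennreal (L\<^sup>2) * emeasure \<nu> (space \<nu>))"
      by (intro mult_left_mono esqrt_mono int_w) simp
    also have "esqrt (ennreal (L\<^sup>2) * emeasure \<nu> (space \<nu>)) = ennreal L * esqrt (emeasure \<nu> (space \<nu>))"
      using \<open>0 \<le> L\<close> by (simp add: esqrt_mult)
    finally show "(\<integral>\<^sup>+x. ennreal \<bar>sqrt (p P0 x) - sqrt (p Q x)\<bar> * esqrt ((?p0 x * inverse (?q x)) * m x) \<partial>mu)
        \<le> ennreal (hellinger mu p P0 Q) * (ennreal L * esqrt (emeasure \<nu> (space \<nu>)))" .
  qed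
  also have "\<dots> = (ennreal (1 - e\<^sup>2 / 2) + ennreal (hellinger mu p P0 Q * L)) * esqrt (emeasure \<nu> (space \<nu>))"
    using ennreal_mult[OF hellinger.nonneg \<open>0 \<le> L\<close>, of P0 Q] by (simp only: distrib_right mult.assoc)
  finally show ?thesis unfolding m_def .
qed

end

section \<open>Convergence from summable roots, and order facts for reciprocals\<close>

lemma esqrt_less_top: "x < top \<Longrightarrow> esqrt x < top"
  by (cases x) auto

text \<open>The terms of a convergent real series tend to zero, and so do their squares. Finiteness
  of the sum makes every root finite, which allows the passage to real numbers.\<close>

lemma ennreal_tendsto_0_of_suminf_esqrt:
  assumes "(\<Sum>n. esqrt (f n)) \<noteq> top"
  shows "f \<longlonglongrightarrow> 0"
proof -
  define g where "g n = enn2real (esqrt (f n))" for n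
  have "esqrt (f n) \<noteq> top" for n
    by (rule less_imp_neq[OF ennreal_suminf_lessD])
      (use assms in \<open>simp only: top.not_eq_extremum\<close>)
  then have g: "esqrt (f n) = ennreal (g n)" "g n \<ge> 0" for n
    by (auto simp: g_def ennreal_enn2real_if)
  have "summable g" using assms g by (intro summable_suminf_not_top) auto
  then have "(\<lambda>n. (g n)\<^sup>2) \<longlonglongrightarrow> 0\<^sup>2" by (intro tendsto_power summable_LIMSEQ_zero)
  then have "(\<lambda>n. ennreal ((g n)\<^sup>2)) \<longlonglongrightarrow> ennreal 0" by (intro tendsto_ennrealI) simp
  moreover have "ennreal ((g n)\<^sup>2) = f n" for n
    using esqrt_power2[of "f n"] g[of n] by (simp add: ennreal_power)
  ultimately show ?thesis by simp
qed

lemma ennreal_inverse_antimono: "x \<le> y \<Longrightarrow> inverse y \<le> inverse (x :: ennreal)"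
proof (cases "x = 0 \<or> y = top")
  case False
  moreover assume "x \<le> y"
  ultimately obtain a b where "x = ennreal a" "y = ennreal b" "0 < a" "a \<le> b"
    by (cases x; cases y) (auto simp: top_unique ennreal_eq_0_iff)
  then show ?thesis by (simp add: inverse_ennreal ennreal_leI le_imp_inverse_le)
qed auto

lemma emeasure_density_space:
  "f \<in> borel_measurable M \<Longrightarrow> emeasure (density M f) (space M) = (\<integral>\<^sup>+x. f x \<partial>M)"
  by (subst emeasure_density) (auto intro!: nn_integral_cong)

section \<open>Likelihoods and iteration over the sample\<close>

context dominated_model
begin

lemma measurable_density_section:
  "x \<in> space mu \<Longrightarrow> (\<lambda>P. p P x) \<in> borel_measurable prior"
  by measurable

definition likelihood :: "nat \<Rightarrow> (nat \<Rightarrow> 'a) \<Rightarrow> 'a measure \<Rightarrow> ennreal"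
  where "likelihood n X P = (\<Prod>i<n. ennreal (p P (X i)))"

lemma likelihood_0 [simp]: "likelihood 0 X P = 1"
  by (simp add: likelihood_def)

text \<open>Prepending matches \<open>S.PiM_iter\<close>, which puts an independent draw in front of
  the sequence; the induction peels off the first observation.\<close>

lemma likelihood_case_nat:
  "likelihood (Suc n) (case_nat x X) P = ennreal (p P x) * likelihood n X P"
  unfolding likelihood_def by (subst prod.lessThan_Suc_shift) simp

text \<open>For splitting reciprocals of products:
  \<open>inverse (x * y) = inverse x * inverse y\<close> fails when one factor is \<open>0\<close>
  and the other \<open>top\<close>.\<close>

lemma likelihood_less_top: "likelihood n X P < top"
  unfolding likelihood_def by (induction n) (auto simp: ennreal_mult_less_top)

lemma measurable_likelihood:
  assumes P0: "P0 \<in> space prior"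
  shows "(\<lambda>(X, P). likelihood n X P) \<in> borel_measurable (PiM UNIV (\<lambda>_. P0) \<Otimes>\<^sub>M prior)"
proof -
  note [measurable_cong] = sets_model[OF P0]
  show ?thesis unfolding likelihood_def by measurable
qed

lemma measurable_likelihood_sample:
  "P0 \<in> space prior \<Longrightarrow> Q \<in> space prior \<Longrightarrow>
    (\<lambda>X. likelihood n X Q) \<in> borel_measurable (PiM UNIV (\<lambda>_. P0))"
  using measurable_compose[OF measurable_Pair2' measurable_likelihood] by simp

lemma measurable_likelihood_model:
  "P0 \<in> space prior \<Longrightarrow> X \<in> space (PiM UNIV (\<lambda>_. P0)) \<Longrightarrow> likelihood n X \<in> borel_measurable prior"
  using measurable_compose[OF measurable_Pair1' measurable_likelihood] by simp

text \<open>The one-step bound iterates: conditionally on the first observation \<open>x\<close>, the remaining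
  ones see the measure \<open>\<nu>\<close> reweighted by \<open>p P x\<close>, which is still carried by \<open>A\<close>.\<close>

lemma likelihood_ratio_power:
  assumes P0: "P0 \<in> space prior" and Q: "Q \<in> space prior"
    and step: "\<And>\<nu>. finite_measure \<nu> \<Longrightarrow> sets \<nu> = sets prior \<Longrightarrow> AE P in \<nu>. P \<in> A \<Longrightarrow>
      (\<integral>\<^sup>+x. esqrt (\<integral>\<^sup>+P. ennreal (p P x) \<partial>\<nu>) * inverse (esqrt (ennreal (p Q x))) \<partial>P0)
        \<le> \<rho> * esqrt (emeasure \<nu> (space \<nu>))"
    and "finite_measure \<nu>" "sets \<nu> = sets prior" "AE P in \<nu>. P \<in> A"
  shows "(\<integral>\<^sup>+X. esqrt (\<integral>\<^sup>+P. likelihood n X P \<partial>\<nu>) * inverse (esqrt (likelihood n X Q)) \<partial>PiM UNIV (\<lambda>_. P0))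
    \<le> \<rho> ^ n * esqrt (emeasure \<nu> (space \<nu>))"
  using assms(4-6)
proof (induction n arbitrary: \<nu>)
  case 0
  interpret P0: prob_space P0 using P0 by (rule model_prob)
  interpret S: sequence_space P0 ..
  show ?case using S.emeasure_space_1 by simp
next
  case (Suc n)
  interpret P0: prob_space P0 using P0 by (rule model_prob)
  interpret S: sequence_space P0 ..
  interpret nu: finite_measure \<nu> by (rule Suc.prems)
  note [measurable_cong] = Suc.prems(2) sets_model[OF P0]
  note [measurable] = density_borel[OF Q] measurable_likelihood[OF P0] measurable_likelihood_sample[OF P0 Q]
  let ?S = "PiM UNIV (\<lambda>_::nat. P0)"
  let ?F = "\<lambda>n \<nu> X. esqrt (\<integral>\<^sup>+P. likelihood n X P \<partial>\<nu>) * inverse (esqrt (likelihood n X Q))"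
  let ?w = "\<lambda>x. inverse (esqrt (ennreal (p Q x)))"
  have F: "?F k \<nu> \<in> borel_measurable ?S" for k
    using Q by measurable
  have space: "space P0 = space mu" using sets_model[OF P0] by (rule sets_eq_imp_space_eq)
  have case_nat: "(\<lambda>(x, X). case_nat x X) \<in> P0 \<Otimes>\<^sub>M ?S \<rightarrow>\<^sub>M ?S"
    by measurable
  have sec: "(\<lambda>P. p P x) \<in> borel_measurable \<nu>" if "x \<in> space mu" for x
    using measurable_density_section[OF that] measurable_cong_sets[OF Suc.prems(2) refl] by blast
  define \<mu> where "\<mu> x = density \<nu> (\<lambda>P. ennreal (p P x))" for x
  have \<mu>_sets: "sets (\<mu> x) = sets prior" for x unfolding \<mu>_def sets_density by (rule Suc.prems)
  have \<mu>_mass: "emeasure (\<mu> x) (space (\<mu> x)) = (\<integral>\<^sup>+P. ennreal (p P x) \<partial>\<nu>)" if "x \<in> space mu" for x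
    unfolding \<mu>_def space_density
    by (intro emeasure_density_space measurable_compose[OF _ measurable_ennreal]) (rule sec[OF that])
  \<comment> \<open>The induction hypothesis needs finite measures. The mixture density integrates
    to the mass of \<open>\<nu>\<close> under \<open>mu\<close>, hence is finite
    \<open>mu\<close>-almost everywhere, and \<open>P0\<close> is dominated by
    \<open>mu\<close>.\<close>
  have AE_fin: "AE x in P0. (\<integral>\<^sup>+P. ennreal (p P x) \<partial>\<nu>) \<noteq> top"
  proof -
    have "AE x in mu. (\<integral>\<^sup>+P. ennreal (p P x) \<partial>\<nu>) \<noteq> \<infinity>"
      by (rule nn_integral_noteq_infinite) (use nn_integral_mixture_density[OF Suc.prems(1,2)] in auto)
    then have "AE x in density mu (\<lambda>x. ennreal (p P0 x)). (\<integral>\<^sup>+P. ennreal (p P x) \<partial>\<nu>) \<noteq> top"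
      using density_borel[OF P0] by (subst AE_density) auto
    then show ?thesis by (simp only: is_density[OF P0])
  qed
  have split: "?F (Suc n) \<nu> (case_nat x X) = ?w x * ?F n (\<mu> x) X"
    if x: "x \<in> space mu" and X: "X \<in> space ?S" for x X
  proof -
    have [measurable]: "(\<lambda>P. p P x) \<in> borel_measurable \<nu>"
      using x by (rule sec)
    note [measurable] = measurable_likelihood_model[OF P0 X]
    have "(\<integral>\<^sup>+P. likelihood (Suc n) (case_nat x X) P \<partial>\<nu>) = (\<integral>\<^sup>+P. likelihood n X P \<partial>\<mu> x)"
      unfolding \<mu>_def likelihood_case_nat by (subst nn_integral_density) auto
    moreover have "inverse (esqrt (likelihood (Suc n) (case_nat x X) Q))
        = ?w x * inverse (esqrt (likelihood n X Q))"
      unfolding likelihood_case_nat esqrt_mult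
      by (intro ennreal_inverse_mult esqrt_less_top ennreal_less_top likelihood_less_top)
    ultimately show ?thesis by (simp add: mult_ac)
  qed
  \<comment> \<open>The product measure is unchanged when an independent draw from \<open>P0\<close>
    is prepended to the sample.\<close>
  have "(\<integral>\<^sup>+X. ?F (Suc n) \<nu> X \<partial>?S) = (\<integral>\<^sup>+X. ?F (Suc n) \<nu> X \<partial>distr (P0 \<Otimes>\<^sub>M ?S) ?S (\<lambda>(x, X). case_nat x X))"
    by (simp only: S.PiM_iter)
  also have "\<dots> = (\<integral>\<^sup>+z. ?F (Suc n) \<nu> (case z of (x, X) \<Rightarrow> case_nat x X) \<partial>(P0 \<Otimes>\<^sub>M ?S))"
    by (rule nn_integral_distr[OF case_nat]) (simp only: measurable_distr_eq1 F)
  also have "\<dots> = (\<integral>\<^sup>+x. \<integral>\<^sup>+X. ?F (Suc n) \<nu> (case_nat x X) \<partial>?S \<partial>P0)"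
    by (subst S.nn_integral_fst[symmetric, OF measurable_compose[OF case_nat F]]) simp
  also have "\<dots> = (\<integral>\<^sup>+x. \<integral>\<^sup>+X. ?w x * ?F n (\<mu> x) X \<partial>?S \<partial>P0)"
    by (intro nn_integral_cong split) (auto simp: space)
  also have "\<dots> \<le> (\<integral>\<^sup>+x. ?w x * (\<rho> ^ n * esqrt (\<integral>\<^sup>+P. ennreal (p P x) \<partial>\<nu>)) \<partial>P0)"
  proof (rule nn_integral_mono_AE)
    show "AE x in P0. (\<integral>\<^sup>+X. ?w x * ?F n (\<mu> x) X \<partial>?S)
        \<le> ?w x * (\<rho> ^ n * esqrt (\<integral>\<^sup>+P. ennreal (p P x) \<partial>\<nu>))"
      using AE_fin AE_space
    proof eventually_elim
      case (elim x)
      then have x: "x \<in> space mu" by (simp add: space)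
      have [measurable]: "(\<lambda>P. p P x) \<in> borel_measurable \<nu>"
      using x by (rule sec)
      have fin: "finite_measure (\<mu> x)"
        using elim \<mu>_mass[OF x] by (intro finite_measureI) simp
      interpret mux: finite_measure "\<mu> x" by (rule fin)
      note [measurable_cong] = \<mu>_sets
      have "AE P in \<mu> x. P \<in> A"
        unfolding \<mu>_def using Suc.prems(3) by (subst AE_density) auto
      note IH = Suc.IH[OF fin \<mu>_sets this]
      have "(\<integral>\<^sup>+X. ?w x * ?F n (\<mu> x) X \<partial>?S) = ?w x * (\<integral>\<^sup>+X. ?F n (\<mu> x) X \<partial>?S)"
        using Q by (intro nn_integral_cmult) measurable
      also have "\<dots> \<le> ?w x * (\<rho> ^ n * esqrt (\<integral>\<^sup>+P. ennreal (p P x) \<partial>\<nu>))"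
        using IH unfolding \<mu>_mass[OF x] by (rule mult_left_mono) simp
      finally show ?case .
    qed
  qed
  also have "\<dots> = (\<integral>\<^sup>+x. \<rho> ^ n * (esqrt (\<integral>\<^sup>+P. ennreal (p P x) \<partial>\<nu>) * ?w x) \<partial>P0)"
    by (simp add: mult_ac)
  also have "\<dots> = \<rho> ^ n * (\<integral>\<^sup>+x. esqrt (\<integral>\<^sup>+P. ennreal (p P x) \<partial>\<nu>) * ?w x \<partial>P0)"
    by (intro nn_integral_cmult) measurable
  \<comment> \<open>What remains is the one-step integral of the original \<open>\<nu>\<close>; it
    supplies the last factor \<open>\<rho>\<close>.\<close>
  also have "\<dots> \<le> \<rho> ^ n * (\<rho> * esqrt (emeasure \<nu> (space \<nu>)))"
    by (intro mult_left_mono step Suc.prems) simp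
  finally show ?case by (simp add: mult_ac)
qed

section \<open>Posterior masses under a one-step bound\<close>

lemma posterior_eq:
  assumes "A \<in> sets prior"
  shows "posterior prior p n X A = (\<integral>\<^sup>+P. likelihood n X P * indicator A P \<partial>prior) / (\<integral>\<^sup>+P. likelihood n X P \<partial>prior)"
  by (simp add: posterior_def likelihood_def)

lemma posterior_measurable:
  assumes P0: "P0 \<in> space prior" and [measurable]: "A \<in> sets prior"
  shows "(\<lambda>X. posterior prior p n X A) \<in> borel_measurable (PiM UNIV (\<lambda>_. P0))"
proof -
  note [measurable] = measurable_likelihood[OF P0]
  show ?thesis unfolding posterior_eq[OF assms(2)] by measurable
qed

text \<open>Separates the probabilistic argument from the geometry, which enters only through
  \<open>step\<close>: alternatives in \<open>A\<close>, comparison measures in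
  \<open>B\<close>.\<close>

lemma posterior_tendsto_0:
  assumes P0: "P0 \<in> space prior" and A [measurable]: "A \<in> sets prior"
    and B [measurable]: "B \<in> sets prior" and pos: "emeasure prior B > 0"
    and \<rho>: "0 \<le> \<rho>" "\<rho> < 1"
    and step: "\<And>Q \<nu>. Q \<in> B \<Longrightarrow> finite_measure \<nu> \<Longrightarrow> sets \<nu> = sets prior \<Longrightarrow> AE P in \<nu>. P \<in> A \<Longrightarrow>
      (\<integral>\<^sup>+x. esqrt (\<integral>\<^sup>+P. ennreal (p P x) \<partial>\<nu>) * inverse (esqrt (ennreal (p Q x))) \<partial>P0)
        \<le> ennreal \<rho> * esqrt (emeasure \<nu> (space \<nu>))"
  shows "AE X in PiM UNIV (\<lambda>_. P0). (\<lambda>n. posterior prior p n X A) \<longlonglongrightarrow> 0"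
proof -
  interpret P0: prob_space P0 using P0 by (rule model_prob)
  interpret S: sequence_space P0 ..
  let ?S = "PiM UNIV (\<lambda>_::nat. P0)"
  note [measurable] = measurable_likelihood[OF P0]
  have post [measurable]: "(\<lambda>X. posterior prior p n X A) \<in> borel_measurable ?S" for n
    using P0 A by (rule posterior_measurable)
  \<comment> \<open>The prior restricted to \<open>A\<close> and to \<open>B\<close> but not
    normalised, since \<open>A\<close> may have mass zero.\<close>
  define \<nu>A \<nu>B where "\<nu>A = density prior (indicator A)" and "\<nu>B = density prior (indicator B)"
  have sets [measurable_cong]: "sets \<nu>A = sets prior" "sets \<nu>B = sets prior"
    by (simp_all add: \<nu>A_def \<nu>B_def)
  define b where "b = measure prior B"
  have b: "b > 0" "emeasure prior B = ennreal b" "b \<le> 1"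
    using pos by (auto simp: b_def prior.emeasure_eq_measure)
  have mass: "emeasure \<nu>A (space \<nu>A) \<le> 1" "emeasure \<nu>B (space \<nu>B) = ennreal b"
    using b prior.emeasure_le_1[of A] by (simp_all add: \<nu>A_def \<nu>B_def emeasure_restricted)
  interpret A: finite_measure \<nu>A using mass(1) by (intro finite_measureI) (auto simp: top_unique)
  interpret B: finite_measure \<nu>B using mass(2) by (intro finite_measureI) auto
  interpret SB: pair_sigma_finite ?S \<nu>B ..
  \<comment> \<open>The factor that Jensen's inequality produces on \<open>\<nu>B\<close>, of mass
    \<open>b\<close>.\<close>
  define bb where "bb = b * sqrt b"
  have bb: "bb > 0" using b by (simp add: bb_def)
  have expect: "(\<integral>\<^sup>+X. ennreal bb * esqrt (posterior prior p n X A) \<partial>?S) \<le> ennreal (\<rho> ^ n)" for n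
  proof -
    let ?N = "\<lambda>X. \<integral>\<^sup>+P. likelihood n X P \<partial>\<nu>A"
    have "(\<integral>\<^sup>+X. ennreal bb * esqrt (posterior prior p n X A) \<partial>?S)
        \<le> (\<integral>\<^sup>+X. (\<integral>\<^sup>+Q. esqrt (?N X) * inverse (esqrt (likelihood n X Q)) \<partial>\<nu>B) \<partial>?S)"
    proof (rule nn_integral_mono)
      fix X assume X: "X \<in> space ?S"
      note [measurable] = measurable_likelihood_model[OF P0 X]
      let ?D = "\<integral>\<^sup>+P. likelihood n X P \<partial>prior" and ?DB = "\<integral>\<^sup>+P. likelihood n X P \<partial>\<nu>B"
      have "?DB = (\<integral>\<^sup>+P. indicator B P * likelihood n X P \<partial>prior)"
        unfolding \<nu>B_def by (rule nn_integral_density) measurable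
      \<comment> \<open>Integrating over \<open>B\<close> alone can only lower the denominator,
        hence raise the quotient.\<close>
      also have "\<dots> \<le> ?D" by (intro nn_integral_mono) (auto split: split_indicator)
      finally have DB: "?DB \<le> ?D" .
      have "?N X = (\<integral>\<^sup>+P. indicator A P * likelihood n X P \<partial>prior)"
        unfolding \<nu>A_def by (rule nn_integral_density) measurable
      then have "posterior prior p n X A = ?N X / ?D" by (simp add: posterior_eq[OF A] mult.commute)
      \<comment> \<open>The conventional values at denominators \<open>0\<close> and
        \<open>top\<close> need no separate treatment, as \<open>jensen_inverse_esqrt\<close> admits
        both.\<close>
      then have "ennreal bb * esqrt (posterior prior p n X A)
          = esqrt (?N X) * (ennreal bb * inverse (esqrt ?D))"
        by (simp add: divide_ennreal_def esqrt_mult esqrt_inverse mult_ac)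
      also have "\<dots> \<le> esqrt (?N X) * (ennreal bb * inverse (esqrt ?DB))"
        by (intro mult_left_mono ennreal_inverse_antimono esqrt_mono DB) simp_all
      also have "\<dots> \<le> esqrt (?N X) * (\<integral>\<^sup>+Q. inverse (esqrt (likelihood n X Q)) \<partial>\<nu>B)"
        unfolding bb_def by (intro mult_left_mono jensen_inverse_esqrt mass b) measurable
      also have "\<dots> = (\<integral>\<^sup>+Q. esqrt (?N X) * inverse (esqrt (likelihood n X Q)) \<partial>\<nu>B)"
        by (rule nn_integral_cmult[symmetric]) measurable
      finally show "ennreal bb * esqrt (posterior prior p n X A) \<le> \<dots>" .
    qed
    \<comment> \<open>Once the integrals are exchanged, \<open>Q\<close> is fixed and the
      likelihood-ratio bound applies for each \<open>Q\<close> in \<open>B\<close>.\<close>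
    also have "\<dots> = (\<integral>\<^sup>+Q. (\<integral>\<^sup>+X. esqrt (?N X) * inverse (esqrt (likelihood n X Q)) \<partial>?S) \<partial>\<nu>B)"
      by (rule SB.Fubini'[symmetric]) measurable
    also have "\<dots> \<le> (\<integral>\<^sup>+Q. ennreal \<rho> ^ n * esqrt (emeasure \<nu>A (space \<nu>A)) \<partial>\<nu>B)"
    proof (rule nn_integral_mono_AE)
      have "AE Q in \<nu>B. Q \<in> B" unfolding \<nu>B_def by (subst AE_density) (auto split: split_indicator_asm)
      then show "AE Q in \<nu>B. (\<integral>\<^sup>+X. esqrt (?N X) * inverse (esqrt (likelihood n X Q)) \<partial>?S)
          \<le> ennreal \<rho> ^ n * esqrt (emeasure \<nu>A (space \<nu>A))"
      proof eventually_elim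
        case (elim Q)
        have Q: "Q \<in> space prior" using elim sets.sets_into_space[OF B] by auto
        show ?case
        proof (rule likelihood_ratio_power[OF P0 Q, of A])
          show "AE P in \<nu>A. P \<in> A" unfolding \<nu>A_def by (subst AE_density) (auto split: split_indicator_asm)
        qed (use step[OF elim] sets A.finite_measure_axioms in auto)
      qed
    qed
    also have "\<dots> = ennreal \<rho> ^ n * (esqrt (emeasure \<nu>A (space \<nu>A)) * ennreal b)"
      by (simp add: mass(2) mult.assoc)
    also have "\<dots> \<le> ennreal \<rho> ^ n * (1 * 1)"
      using b esqrt_mono[OF mass(1)] by (intro mult_left_mono mult_mono) auto
    finally show ?thesis using \<rho> by (simp add: ennreal_power)
  qed
  \<comment> \<open>Exchanging sum and expectation turns the geometric bounds into almost sure
    finiteness of the sum, without a Borel-Cantelli argument.\<close>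
  have "(\<integral>\<^sup>+X. (\<Sum>n. ennreal bb * esqrt (posterior prior p n X A)) \<partial>?S)
      = (\<Sum>n. \<integral>\<^sup>+X. ennreal bb * esqrt (posterior prior p n X A) \<partial>?S)"
    by (rule nn_integral_suminf) measurable
  also have "\<dots> \<le> (\<Sum>n. ennreal (\<rho> ^ n))" by (intro suminf_le expect) auto
  also have "\<dots> = ennreal (\<Sum>n. \<rho> ^ n)" using \<rho> by (intro suminf_ennreal2 summable_geometric) auto
  finally have "(\<integral>\<^sup>+X. (\<Sum>n. ennreal bb * esqrt (posterior prior p n X A)) \<partial>?S) \<noteq> \<infinity>"
    by (auto simp: top_unique)
  then have "AE X in ?S. (\<Sum>n. ennreal bb * esqrt (posterior prior p n X A)) \<noteq> \<infinity>"
    by (intro nn_integral_noteq_infinite) measurable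
  then show ?thesis
  proof eventually_elim
    case (elim X)
    then show ?case
      using bb by (intro ennreal_tendsto_0_of_suminf_esqrt) (auto simp: ennreal_mult_eq_top_iff)
  qed
qed

end

section \<open>Hellinger consistency by a finite cover\<close>

theorem theorem3p4:
  fixes mu :: "'a measure" and prior :: "'a measure measure"
    and p :: "'a measure \<Rightarrow> 'a \<Rightarrow> real" and P0 :: "'a measure"
  assumes model: "dominated_model mu prior p"
    and tb: "Metric_space.mtotally_bounded (space prior) (hellinger mu p) (space prior)"
    and P0: "P0 \<in> space prior"
    and ratio: "\<exists>L>0. \<exists>r>0. \<forall>P\<in>space prior. \<forall>Q\<in>Metric_space.mball (space prior) (hellinger mu p) P0 r.
      ratio_norm2 mu (p P) (p Q) < ennreal L"
    and support: "\<forall>B\<in>sets prior.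
      (\<exists>r>0. Metric_space.mball (space prior) (hellinger mu p) P0 r \<subseteq> B) \<longrightarrow> emeasure prior B > 0"
  shows "\<forall>\<epsilon>>0. AE X in PiM UNIV (\<lambda>_::nat. P0).
    (\<lambda>n. posterior prior p n X {P \<in> space prior. hellinger mu p P P0 > \<epsilon>}) \<longlonglongrightarrow> 0"
proof (intro allI impI)
  fix \<epsilon> :: real assume \<epsilon>: "\<epsilon> > 0"
  interpret dominated_model mu prior p by (rule model)
  let ?H = "hellinger mu p"
  \<comment> \<open>Joint measurability of the densities and sigma-finiteness of \<open>mu\<close>
    make the distance measurable in \<open>P\<close>; balls are then measurable, as
    \<open>support\<close> and \<open>posterior_tendsto_0\<close> require.\<close>
  have meas_H [measurable]: "(\<lambda>P. ?H P K) \<in> borel_measurable prior" if K: "K \<in> space prior" for K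
  proof -
    note [measurable] = density_borel[OF K]
    show ?thesis unfolding hellinger_def by measurable
  qed
  have ball: "hellinger.mball K s \<in> sets prior" if K: "K \<in> space prior" for K s
  proof -
    have "hellinger.mball K s = {P \<in> space prior. ?H P K < s}"
      using K by (auto simp: hellinger.commute)
    then show ?thesis using meas_H[OF K] by simp
  qed
  obtain L r where L: "L > 0" "r > 0"
    and norm_lt: "\<And>P Q. P \<in> space prior \<Longrightarrow> Q \<in> hellinger.mball P0 r \<Longrightarrow> ratio_norm2 mu (p P) (p Q) < ennreal L"
    using ratio by blast
  have ratio_le: "(\<integral>\<^sup>+x. (ennreal (p P x))\<^sup>2 / ennreal (p Q x) \<partial>mu) \<le> ennreal (L\<^sup>2)"
    if "P \<in> space prior" "Q \<in> hellinger.mball P0 r" for P Q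
  proof -
    define I where "I = (\<integral>\<^sup>+x. (ennreal (p P x))\<^sup>2 / ennreal (p Q x) \<partial>mu)"
    have "esqrt I < ennreal L"
      using norm_lt[OF that] by (simp add: ratio_norm2_def esqrt_def Let_def I_def)
    then have "(esqrt I)\<^sup>2 \<le> (ennreal L)\<^sup>2" by (intro power_mono) auto
    then show ?thesis using L by (simp add: I_def ennreal_power)
  qed
  \<comment> \<open>The centre of an \<open>e\<close>-ball meeting the set of distances above
    \<open>\<epsilon> = 4 * e\<close> is more than \<open>e + 2 * e\<close> from \<open>P0\<close>,
    so mixtures over that ball stay \<open>2 * e\<close> away and have affinity at most
    \<open>1 - 2 * e^2\<close>. The choice of \<open>s\<close> makes the change from
    \<open>P0\<close> to \<open>Q\<close> cost at most \<open>e^2\<close>, and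
    \<open>s \<le> r\<close> keeps \<open>Q\<close> in the ball where \<open>ratio\<close>
    holds.\<close>
  define e s where "e = \<epsilon> / 4" and "s = min r (min (e\<^sup>2) (1 / 2) / L)"
  have e: "e > 0" using \<epsilon> by (simp add: e_def)
  have s: "s > 0" "s \<le> r" using L e unfolding s_def by simp_all
  have sL: "s * L \<le> min (e\<^sup>2) (1 / 2)"
    unfolding pos_le_divide_eq[OF L(1), symmetric] s_def by (rule min.cobounded2)
  \<comment> \<open>The \<open>max\<close> mirrors the truncation of negative numbers by
    \<open>ennreal\<close>. The value is at most \<open>1 - e^2\<close> if the first term is
    positive and at most \<open>1 / 2\<close> otherwise, which is why \<open>s * L\<close> is also
    capped by \<open>1 / 2\<close>.\<close>
  define \<rho> where "\<rho> = max 0 (1 - (2 * e)\<^sup>2 / 2) + min (e\<^sup>2) (1 / 2)"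
  have \<rho>: "0 \<le> \<rho>" "\<rho> < 1"
  proof -
    have "e\<^sup>2 > 0" "(2 * e)\<^sup>2 / 2 = 2 * e\<^sup>2" using e by (simp_all add: power_mult_distrib)
    then show "0 \<le> \<rho>" "\<rho> < 1" unfolding \<rho>_def by linarith+
  qed
  let ?V = "{P \<in> space prior. ?H P P0 > \<epsilon>}"
  obtain C where C: "finite C" "C \<subseteq> space prior" "space prior \<subseteq> (\<Union>K\<in>C. hellinger.mball K e)"
    using tb[unfolded hellinger.mtotally_bounded_def] e by meson
  have V: "?V \<in> sets prior" using meas_H[OF P0] by measurable
  have piece: "AE X in PiM UNIV (\<lambda>_::nat. P0). (\<lambda>n. posterior prior p n X (?V \<inter> hellinger.mball K e)) \<longlonglongrightarrow> 0"
    if "K \<in> C" for K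
  \<comment> \<open>The centres of the net need not lie in \<open>?V\<close>: a ball missing
    \<open>?V\<close> contributes nothing, and one meeting it supplies a point from which
    \<open>far\<close> follows.\<close>
  proof (cases "?V \<inter> hellinger.mball K e = {}")
    case True
    then show ?thesis by (simp add: posterior_def)
  next
    case False
    have K: "K \<in> space prior" using that C by auto
    from False obtain P where P: "P \<in> space prior" "?H P P0 > \<epsilon>" "?H K P < e" by auto
    have far: "e + 2 * e \<le> ?H K P0"
      using hellinger.triangle[OF P(1) K P0] P hellinger.commute[of P K] by (simp add: e_def)
    show ?thesis
    proof (rule posterior_tendsto_0[OF P0 _ ball[OF P0, of s] _ \<rho>])
      show "?V \<inter> hellinger.mball K e \<in> sets prior" using V ball[OF K] by simp
      show "emeasure prior (hellinger.mball P0 s) > 0" using support ball[OF P0, of s] s(1) by blast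
      fix Q and \<nu> :: "'a measure measure"
      assume Q: "Q \<in> hellinger.mball P0 s" and fin: "finite_measure \<nu>" and sets: "sets \<nu> = sets prior"
        and near: "AE P in \<nu>. P \<in> ?V \<inter> hellinger.mball K e"
      have Q': "Q \<in> space prior" "?H P0 Q \<le> s" "Q \<in> hellinger.mball P0 r" using Q s(2) by auto
      have "(\<integral>\<^sup>+x. esqrt (\<integral>\<^sup>+P. ennreal (p P x) \<partial>\<nu>) * inverse (esqrt (ennreal (p Q x))) \<partial>P0)
          \<le> (ennreal (1 - (2 * e)\<^sup>2 / 2) + ennreal (?H P0 Q * L)) * esqrt (emeasure \<nu> (space \<nu>))"
      proof (rule mixture_likelihood_ratio[OF fin sets K P0 Q'(1)])
        show "AE P in \<nu>. ?H P K \<le> e" using near by eventually_elim (auto simp: hellinger.commute)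
        show "e + 2 * e \<le> ?H K P0" by (rule far)
      qed (use e L ratio_le Q'(3) in auto)
      also have "\<dots> \<le> ennreal \<rho> * esqrt (emeasure \<nu> (space \<nu>))"
      proof (rule mult_right_mono)
        have "?H P0 Q * L \<le> s * L" using Q'(2) L by simp
        then have "ennreal (1 - (2 * e)\<^sup>2 / 2) + ennreal (?H P0 Q * L)
            \<le> ennreal (max 0 (1 - (2 * e)\<^sup>2 / 2)) + ennreal (min (e\<^sup>2) (1 / 2))"
          using sL by (intro add_mono ennreal_leI max.cobounded2) linarith
        also have "\<dots> = ennreal \<rho>" unfolding \<rho>_def by (rule ennreal_plus[symmetric]) auto
        finally show "ennreal (1 - (2 * e)\<^sup>2 / 2) + ennreal (?H P0 Q * L) \<le> ennreal \<rho>" .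
      qed simp
      finally show "(\<integral>\<^sup>+x. esqrt (\<integral>\<^sup>+P. ennreal (p P x) \<partial>\<nu>) * inverse (esqrt (ennreal (p Q x))) \<partial>P0)
          \<le> ennreal \<rho> * esqrt (emeasure \<nu> (space \<nu>))" .
    qed
  qed
  \<comment> \<open>Balls may overlap, so only subadditivity of the numerators is available; the
    denominator is common to all terms.\<close>
  have cover: "posterior prior p n X ?V \<le> (\<Sum>K\<in>C. posterior prior p n X (?V \<inter> hellinger.mball K e))"
    if X: "X \<in> space (PiM UNIV (\<lambda>_::nat. P0))" for n X
  proof -
    note [measurable] = measurable_likelihood_model[OF P0 X]
    have W: "?V \<inter> hellinger.mball K e \<in> sets prior" if "K \<in> C" for K
      using V ball[of K e] that C(2) by auto
    have "(\<integral>\<^sup>+P. likelihood n X P * indicator ?V P \<partial>prior)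
        \<le> (\<integral>\<^sup>+P. (\<Sum>K\<in>C. likelihood n X P * indicator (?V \<inter> hellinger.mball K e) P) \<partial>prior)"
    proof (rule nn_integral_mono)
      fix P assume P: "P \<in> space prior"
      then obtain K where K: "K \<in> C" "P \<in> hellinger.mball K e" using C(3) by blast
      have "likelihood n X P * indicator ?V P = likelihood n X P * indicator (?V \<inter> hellinger.mball K e) P"
        using K(2) by (simp add: indicator_def)
      also have "\<dots> \<le> (\<Sum>K\<in>C. likelihood n X P * indicator (?V \<inter> hellinger.mball K e) P)"
        using C(1) K(1) by (intro member_le_sum) auto
      finally show "likelihood n X P * indicator ?V P \<le> \<dots>" .
    qed
    also have "\<dots> = (\<Sum>K\<in>C. \<integral>\<^sup>+P. likelihood n X P * indicator (?V \<inter> hellinger.mball K e) P \<partial>prior)"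
      by (rule nn_integral_sum) (use W in measurable)
    finally have "posterior prior p n X ?V \<le> (\<Sum>K\<in>C. \<integral>\<^sup>+P. likelihood n X P * indicator (?V \<inter> hellinger.mball K e) P \<partial>prior)
        / (\<integral>\<^sup>+P. likelihood n X P \<partial>prior)"
      unfolding posterior_eq[OF V] by (rule divide_right_mono_ennreal)
    also have "\<dots> = (\<Sum>K\<in>C. posterior prior p n X (?V \<inter> hellinger.mball K e))"
      unfolding divide_ennreal_def sum_distrib_right
      by (intro sum.cong refl) (simp only: posterior_eq[OF W] divide_ennreal_def)
    finally show ?thesis .
  qed
  \<comment> \<open>There are finitely many pieces, so their exceptional null sets combine into
    one.\<close>
  have "AE X in PiM UNIV (\<lambda>_::nat. P0). \<forall>K\<in>C. (\<lambda>n. posterior prior p n X (?V \<inter> hellinger.mball K e)) \<longlonglongrightarrow> 0"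
    using piece C(1) by (intro AE_finite_allI) auto
  then show "AE X in PiM UNIV (\<lambda>_::nat. P0). (\<lambda>n. posterior prior p n X ?V) \<longlonglongrightarrow> 0"
    using AE_space
  proof eventually_elim
    case (elim X)
    have "(\<lambda>n. \<Sum>K\<in>C. posterior prior p n X (?V \<inter> hellinger.mball K e)) \<longlonglongrightarrow> (\<Sum>K\<in>C. 0)"
      using elim(1) by (intro tendsto_sum) auto
    then have lim: "(\<lambda>n. \<Sum>K\<in>C. posterior prior p n X (?V \<inter> hellinger.mball K e)) \<longlonglongrightarrow> 0"
      by simp
    show ?case
      by (rule tendsto_sandwich[OF _ _ tendsto_const lim]) (auto intro!: always_eventually cover elim(2))
  qed
qed

end
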